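(* Let $\mathcal P$ be an $\mathscr S$-invariant finite-dimensional space of polynomials in $n$ real variables, $M=\dim\mathcal P$, and let $\mathcal X=\{x_1,\dots,x_M\}\subset\mathbb R^n$ be a $\mathcal P$-unisolvent set with Lagrange polynomials $\mathscr L_1,\dots,\mathscr L_M\in\mathcal P$. Let $\mathbf S\in\mathbb R^{M\times M}$ be the matrix $\mathbf S_{i,j}=\sum_{\ell=1}^L\mu_\ell\,\mathscr L_j(S_\ell(x_i))$. Then the problem $$\text{find } \mathbf w\in\operatorname{Ker}(I-\mathbf S^{\top})\ \text{ such that }\ w_1+\cdots+w_M=1$$ is well-posed (it has exactly one solution $\mathbf w$), and this solution is the vector of exact cubature weights, $w_i=\int_\Gamma\mathscr L_i\,d\mu$ for $1\le i\le M$.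
   Context: Affine IFS: $\mathscr S=\{S_\ell:\mathbb R^n\to\mathbb R^n\}_{\ell=1}^L$, $L\ge2$, with $S_\ell(x)=A_\ell x+b_\ell$ and spectral norm $\rho_\ell=\|A_\ell\|<1$. Its attractor $\Gamma$ is the unique nonempty compact set with $\Gamma=\bigcup_{\ell=1}^L S_\ell(\Gamma)$. Fix $\mu_1,\dots,\mu_L\in(0,1)$ with $\sum_\ell\mu_\ell=1$; $\mu$ is the unique Borel regular probability measure (on a closed ball $F$ with $\bigcup_\ell S_\ell(F)\subset F$) satisfying $\mu=\sum_\ell\mu_\ell\,\mu\circ S_\ell^{-1}$; its support is $\Gamma$. Ruelle operator: $\mathscr F[f]=\sum_{\ell=1}^L\mu_\ell\, f\circ S_\ell$. A finite-dimensional space $\mathcal P$ of polynomials is $\mathscr S$-invariant if it contains the constants and $\mathscr F(\mathcal P)\subset\mathcal P$. A set $\mathcal X$ of $M=\dim\mathcal P$ points is $\mathcal P$-unisolvent if $p\mapsto(p(x_1),\dots,p(x_M))$ is injective on $\mathcal P$; the Lagrange polynomials $\mathscr L_i\in\mathcal P$ are then defined by $\mathscr L_i(x_j)=\delta_{i,j}$. *)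

theory Defs
  imports "HOL-Analysis.Analysis" "HOL-Probability.Probability" "HOL-Library.Function_Algebras"
begin

text \<open>
  Real-valued functions as a real vector space with pointwise operations. The type
  \<open>'a \<Rightarrow> real\<close> is not an instance of \<open>real_vector\<close>, so \<open>subspace\<close>, \<open>span\<close> and \<open>dim\<close>
  for sets of functions come from this interpretation.
\<close>

global_interpretation fun_vs: vector_space "\<lambda>(c::real) (f::'a \<Rightarrow> real) x. c * f x"
  by unfold_locales (auto simp: fun_eq_iff algebra_simps)

definition affine_map :: "real^'n^'n \<Rightarrow> real^'n \<Rightarrow> real^'n \<Rightarrow> real^'n" where
  "affine_map A b x = A *v x + b"

text \<open>
  The index type \<open>'l\<close> plays the role of \<open>{1,\<dots>,L}\<close>. The operator norm with respect to the
  Euclidean norm is the spectral norm.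
\<close>

definition contractive_affine_ifs :: "('l::finite \<Rightarrow> real^'n^'n) \<Rightarrow> bool" where
  "contractive_affine_ifs A \<longleftrightarrow> CARD('l) \<ge> 2 \<and> (\<forall>l. onorm ((*v) (A l)) < 1)"

definition is_attractor :: "('l::finite \<Rightarrow> real^'n \<Rightarrow> real^'n) \<Rightarrow> (real^'n) set \<Rightarrow> bool" where
  "is_attractor S \<Gamma> \<longleftrightarrow> \<Gamma> \<noteq> {} \<and> compact \<Gamma> \<and> \<Gamma> = (\<Union>l. S l ` \<Gamma>)"

definition probability_weights :: "('l::finite \<Rightarrow> real) \<Rightarrow> bool" where
  "probability_weights p \<longleftrightarrow> (\<forall>l. 0 < p l \<and> p l < 1) \<and> (\<Sum>l\<in>UNIV. p l) = 1"

text \<open>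
  A measure on the closed ball is represented by its extension by zero to the Borel sets of
  the whole space, i.e. a Borel measure giving full mass to the ball. Regularity need not be
  required: every finite Borel measure on a Euclidean space is regular.
\<close>

definition is_invariant_measure ::
    "('l::finite \<Rightarrow> real^'n \<Rightarrow> real^'n) \<Rightarrow> ('l \<Rightarrow> real) \<Rightarrow> (real^'n) measure \<Rightarrow> bool" where
  "is_invariant_measure S p \<mu> \<longleftrightarrow>
     prob_space \<mu> \<and> sets \<mu> = sets borel \<and>
     (\<exists>c r. r > 0 \<and> (\<Union>l. S l ` cball c r) \<subseteq> cball c r \<and> measure \<mu> (cball c r) = 1) \<and>
     (\<forall>B\<in>sets borel. measure \<mu> B = (\<Sum>l\<in>UNIV. p l * measure \<mu> (S l -` B)))"

definition ruelle ::
    "('l::finite \<Rightarrow> real^'n \<Rightarrow> real^'n) \<Rightarrow> ('l \<Rightarrow> real) \<Rightarrow> (real^'n \<Rightarrow> real) \<Rightarrow> real^'n \<Rightarrow> real" where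
  "ruelle S p f = (\<lambda>x. \<Sum>l\<in>UNIV. p l * f (S l x))"

text \<open>Polynomials in \<open>n\<close> real variables are identified with polynomial functions on \<open>real^'n\<close>.\<close>

definition finite_dim_poly_space :: "(real^'n \<Rightarrow> real) set \<Rightarrow> bool" where
  "finite_dim_poly_space P \<longleftrightarrow>
     (\<forall>f\<in>P. real_polynomial_function f) \<and> fun_vs.subspace P \<and>
     (\<exists>B. finite B \<and> P = fun_vs.span B)"

definition ifs_invariant_space ::
    "('l::finite \<Rightarrow> real^'n \<Rightarrow> real^'n) \<Rightarrow> ('l \<Rightarrow> real) \<Rightarrow> (real^'n \<Rightarrow> real) set \<Rightarrow> bool" where
  "ifs_invariant_space S p P \<longleftrightarrow> (\<forall>c. (\<lambda>_. c) \<in> P) \<and> ruelle S p ` P \<subseteq> P"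

text \<open>A set of \<open>M\<close> points is given by an injective enumeration over the index type \<open>'m\<close>.\<close>

definition unisolvent :: "(real^'n \<Rightarrow> real) set \<Rightarrow> ('m::finite \<Rightarrow> real^'n) \<Rightarrow> bool" where
  "unisolvent P x \<longleftrightarrow>
     inj x \<and> CARD('m) = fun_vs.dim P \<and> inj_on (\<lambda>q. (\<chi> i. q (x i)) :: real^'m) P"

text \<open>Existence and uniqueness of the described element hold when \<open>x\<close> is unisolvent for \<open>P\<close>.\<close>

definition lagrange ::
    "(real^'n \<Rightarrow> real) set \<Rightarrow> ('m::finite \<Rightarrow> real^'n) \<Rightarrow> 'm \<Rightarrow> real^'n \<Rightarrow> real" where
  "lagrange P x i = (THE q. q \<in> P \<and> (\<forall>j. q (x j) = (if i = j then 1 else 0)))"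

definition transfer_matrix ::
    "('l::finite \<Rightarrow> real^'n \<Rightarrow> real^'n) \<Rightarrow> ('l \<Rightarrow> real) \<Rightarrow> (real^'n \<Rightarrow> real) set \<Rightarrow>
     ('m::finite \<Rightarrow> real^'n) \<Rightarrow> real^'m^'m" where
  "transfer_matrix S p P x = (\<chi> i j. \<Sum>l\<in>UNIV. p l * lagrange P x j (S l (x i)))"

definition matrix_kernel :: "real^'m^'k \<Rightarrow> (real^'m) set" where
  "matrix_kernel A = {v. A *v v = 0}"

definition solves_weight_problem :: "real^'m^'m \<Rightarrow> real^'m \<Rightarrow> bool" where
  "solves_weight_problem T w \<longleftrightarrow>
     w \<in> matrix_kernel (mat 1 - transpose T) \<and> (\<Sum>i\<in>UNIV. w $ i) = 1"

end

theory Submission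
  imports Defs
begin

text \<open>
  A polynomial \<open>q\<close> with \<open>q - ruelle S p q\<close> constant is itself constant: a maximum and a minimum of
  \<open>q\<close> over a compact invariant set propagate along the orbits, and two orbits of one contraction
  approach each other. Hence the kernel of \<open>I - T\<close>, with \<open>T\<close> the transfer matrix, consists of the
  constant vectors and no nonzero constant vector lies in its range; by duality the kernel of the
  transpose contains at most one vector with coordinate sum \<open>1\<close>. The vector of integrals of the
  Lagrange polynomials is such a vector, by invariance of the measure, which is concentrated on the
  attractor because it gives full mass to shrinking neighbourhoods of it.
\<close>

section \<open>Contractions, weighted averages and the Ruelle operator\<close>

text \<open>A point of \<open>K\<close> nearest to \<open>y\<close> has its image in
  \<open>K\<close>, and the distance from that image to \<open>f y\<close> is at most \<rho> times
  the original one.\<close>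

lemma infdist_image_le_contraction:
  fixes f :: "'a::heine_borel \<Rightarrow> 'a"
  assumes "closed K" "K \<noteq> {}" "f ` K \<subseteq> K" "\<And>y z. dist (f y) (f z) \<le> \<rho> * dist y z"
  shows "infdist (f y) K \<le> \<rho> * infdist y K"
proof -
  obtain z where z: "z \<in> K" "infdist y K = dist y z"
    using infdist_attains_inf assms by metis
  then have "infdist (f y) K \<le> dist (f y) (f z)"
    using assms(3) by (intro infdist_le) auto
  with assms(4)[of y z] z show ?thesis by simp
qed

lemma weighted_average_ge:
  assumes "probability_weights p" "\<And>l. c \<le> f l"
  shows "c \<le> (\<Sum>l\<in>UNIV. p l * f l)"
proof -
  have "c = (\<Sum>l\<in>UNIV. p l * c)"
    using assms(1) by (simp add: probability_weights_def flip: sum_distrib_right)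
  also have "\<dots> \<le> (\<Sum>l\<in>UNIV. p l * f l)"
    using assms by (intro sum_mono mult_left_mono) (auto simp: probability_weights_def less_imp_le)
  finally show ?thesis .
qed

text \<open>All weights are strictly positive, so an average that equals a lower bound of its terms
  forces every term to equal it.\<close>

lemma ruelle_eq_lower_bound:
  assumes p: "probability_weights p" and "\<And>l. c \<le> q (S l y)" and eq: "ruelle S p q y = c"
  shows "q (S l y) = c"
proof -
  have "(\<Sum>l\<in>UNIV. p l * (q (S l y) - c)) = ruelle S p q y - c"
    using p by (simp add: ruelle_def probability_weights_def right_diff_distrib sum_subtractf
      flip: sum_distrib_right)
  then have "(\<Sum>l\<in>UNIV. p l * (q (S l y) - c)) = 0" using eq by simp
  moreover have "\<And>l. 0 \<le> p l * (q (S l y) - c)"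
    using assms by (auto simp: probability_weights_def less_imp_le)
  ultimately have "p l * (q (S l y) - c) = 0"
    by (simp add: sum_nonneg_eq_0_iff)
  then show ?thesis using p by (auto simp: probability_weights_def less_le)
qed

text \<open>At a minimum of \<open>q\<close> on an invariant set, \<open>ruelle S p q\<close> cannot be smaller, and if the two
  agree then the minimum propagates along every orbit.\<close>

lemma min_ruelle:
  assumes p: "probability_weights p" and K: "\<And>l. S l ` K \<subseteq> K"
    and y: "y \<in> K" and le: "\<And>z. z \<in> K \<Longrightarrow> q y \<le> q z"
    and eq: "\<And>z. z \<in> K \<Longrightarrow> q z = ruelle S p q z + c"
  shows "c \<le> 0" and "c = 0 \<Longrightarrow> q ((S l ^^ k) y) = q y"
proof -
  have "q y \<le> ruelle S p q y"
    unfolding ruelle_def using K y le by (intro weighted_average_ge[OF p]) auto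
  with eq[OF y] show "c \<le> 0" by simp
  assume c: "c = 0"
  \<comment> \<open>Membership in \<open>K\<close> is carried through the induction because
    \<open>le\<close> and \<open>eq\<close> only speak about points of \<open>K\<close>.\<close>
  have "(S l ^^ k) y \<in> K \<and> q ((S l ^^ k) y) = q y"
  proof (induction k)
    case (Suc k)
    then have *: "ruelle S p q ((S l ^^ k) y) = q y"
      using eq c by fastforce
    have "q (S l ((S l ^^ k) y)) = q y"
      using K le Suc by (intro ruelle_eq_lower_bound[OF p _ *]) auto
    moreover have "S l ((S l ^^ k) y) \<in> K" using K Suc by auto
    ultimately show ?case by simp
  qed (use y in auto)
  then show "q ((S l ^^ k) y) = q y" by blast
qed

lemma ruelle_uminus: "ruelle S p (\<lambda>z. - q z) = (\<lambda>z. - ruelle S p q z)"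
  by (simp add: ruelle_def fun_eq_iff sum_negf)

text \<open>A minimum of \<open>q\<close> gives \<open>c \<le> 0\<close> and a maximum gives
  \<open>c \<ge> 0\<close>. Once \<open>c = 0\<close>, both extreme values persist along orbits of a
  single map; these orbits approach each other, so the extremes coincide.\<close>

lemma ruelle_defect_const:
  fixes S :: "'l::finite \<Rightarrow> real^'n \<Rightarrow> real^'n"
  assumes p: "probability_weights p" and K: "compact K" "\<And>l. S l ` K \<subseteq> K"
    and \<rho>: "0 \<le> \<rho>" "\<rho> < 1" "\<And>l y z. dist (S l y) (S l z) \<le> \<rho> * dist y z"
    and q: "continuous_on K q" and eq: "\<And>z. z \<in> K \<Longrightarrow> q z = ruelle S p q z + c"
    and ab: "a \<in> K" "b \<in> K"
  shows "c = 0 \<and> q a = q b"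
proof -
  obtain y where y: "y \<in> K" "\<And>z. z \<in> K \<Longrightarrow> q y \<le> q z"
    using continuous_attains_inf[OF K(1) _ q] ab by auto
  obtain w where w: "w \<in> K" "\<And>z. z \<in> K \<Longrightarrow> q z \<le> q w"
    using continuous_attains_sup[OF K(1) _ q] ab by auto
  have lo: "c \<le> 0" "c = 0 \<Longrightarrow> q ((S l ^^ k) y) = q y" for l k
    using min_ruelle[OF p K(2) y eq] by blast+
  \<comment> \<open>The function \<open>- q\<close> solves the same equation with
    \<open>- c\<close>, which turns the result on minima into one on maxima.\<close>
  have eq': "- q z = ruelle S p (\<lambda>z. - q z) z + - c" if "z \<in> K" for z
    using eq[OF that] by (simp add: ruelle_uminus)
  have w': "- q w \<le> - q z" if "z \<in> K" for z
    using w(2)[OF that] by simp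
  have hi: "- c \<le> 0" "c = 0 \<Longrightarrow> q ((S l ^^ k) w) = q w" for l k
    using min_ruelle[where q = "\<lambda>z. - q z" and c = "- c", OF p K(2) w(1) w' eq'] by auto
  from lo(1) hi(1) have c: "c = 0" by simp
  obtain l :: 'l where True by blast
  have inv: "(S l ^^ k) z \<in> K" if "z \<in> K" for k z
    using K(2) that by (induction k) auto
  have "dist ((S l ^^ k) y) ((S l ^^ k) w) \<le> \<rho> ^ k * dist y w" for k
  proof (induction k)
    case (Suc k)
    have "dist ((S l ^^ Suc k) y) ((S l ^^ Suc k) w) \<le> \<rho> * dist ((S l ^^ k) y) ((S l ^^ k) w)"
      using \<rho>(3) by simp
    also have "\<dots> \<le> \<rho> * (\<rho> ^ k * dist y w)"
      using Suc \<rho>(1) by (rule mult_left_mono)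
    finally show ?case by (simp add: mult.assoc)
  qed simp
  moreover have "(\<lambda>k. \<rho> ^ k * dist y w) \<longlonglongrightarrow> 0"
    using \<rho> by (intro tendsto_mult_left_zero LIMSEQ_power_zero) auto
  ultimately have "(\<lambda>k. dist ((S l ^^ k) y) ((S l ^^ k) w)) \<longlonglongrightarrow> 0"
    by (rule_tac Lim_null_comparison[rotated]) auto
  \<comment> \<open>Uniform continuity allows \<open>q\<close> to be compared along two sequences
    whose mutual distance tends to zero, without a limit point for either.\<close>
  moreover have "uniformly_continuous_on K q"
    using q K(1) by (rule compact_uniformly_continuous)
  ultimately have "(\<lambda>k. dist (q ((S l ^^ k) y)) (q ((S l ^^ k) w))) \<longlonglongrightarrow> 0"
    using inv[OF y(1)] inv[OF w(1)] unfolding uniformly_continuous_on_sequentially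
    by (elim allE[of _ "\<lambda>k. (S l ^^ k) y"] allE[of _ "\<lambda>k. (S l ^^ k) w"]) simp
  then have "q y = q w"
    using lo(2)[OF c] hi(2)[OF c] by (simp add: LIMSEQ_const_iff)
  then show ?thesis
    using c y(2)[OF ab(1)] y(2)[OF ab(2)] w(2)[OF ab(1)] w(2)[OF ab(2)] by simp
qed

section \<open>The invariant measure: concentration on the attractor and invariance of
  integrals\<close>

text \<open>The closed \<open>t\<close>-neighbourhood of \<Gamma> lies in the preimage of the
  \<open>\<rho> * t\<close>-neighbourhood under every map, so invariance makes the latter at least
  as heavy. Iteration from a neighbourhood containing a ball of full mass leaves full mass on the
  intersection, which is \<Gamma>.\<close>

lemma AE_in_attractor:
  fixes S :: "'l::finite \<Rightarrow> real^'n \<Rightarrow> real^'n"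
  assumes p: "probability_weights p" and mu: "is_invariant_measure S p \<mu>"
    and G: "is_attractor S \<Gamma>"
    and S: "\<And>l. S l \<in> borel_measurable borel"
    and \<rho>: "0 \<le> \<rho>" "\<rho> < 1" "\<And>l y z. dist (S l y) (S l z) \<le> \<rho> * dist y z"
  shows "AE y in \<mu>. y \<in> \<Gamma>"
proof -
  interpret prob_space \<mu> using mu by (simp add: is_invariant_measure_def)
  have sets[measurable_cong, simp]: "sets \<mu> = sets borel"
    using mu by (simp add: is_invariant_measure_def)
  have space[simp]: "space \<mu> = UNIV"
    using sets_eq_imp_space_eq[OF sets] by simp
  have ne: "\<Gamma> \<noteq> {}" and comp: "compact \<Gamma>" and inv: "\<And>l. S l ` \<Gamma> \<subseteq> \<Gamma>"
    using G unfolding is_attractor_def by blast+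
  note [measurable] = S
  define N where "N t = {y. infdist y \<Gamma> \<le> t}" for t
  have N[measurable]: "N t \<in> sets borel" for t
    unfolding N_def by (intro borel_closed closed_Collect_le continuous_intros)
  have step: "prob (N t) \<le> prob (N (\<rho> * t))" for t
  proof -
    have "N t \<subseteq> S l -` N (\<rho> * t)" for l
    proof
      fix y assume "y \<in> N t"
      then have "\<rho> * infdist y \<Gamma> \<le> \<rho> * t"
        using \<rho>(1) by (simp add: N_def mult_left_mono)
      moreover have "infdist (S l y) \<Gamma> \<le> \<rho> * infdist y \<Gamma>"
        using comp ne inv \<rho>(3) by (intro infdist_image_le_contraction) (auto simp: compact_imp_closed)
      ultimately show "y \<in> S l -` N (\<rho> * t)" by (simp add: N_def)
    qed
    moreover have "S l -` N (\<rho> * t) \<in> sets \<mu>" for l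
      using measurable_sets[OF S[of l] N] by simp
    ultimately have "prob (N t) \<le> (\<Sum>l\<in>UNIV. p l * prob (S l -` N (\<rho> * t)))"
      by (intro weighted_average_ge[OF p] finite_measure_mono) auto
    then show ?thesis
      using mu N by (simp add: is_invariant_measure_def)
  qed
  obtain c r where cr: "prob (cball c r) = 1"
    using mu unfolding is_invariant_measure_def by blast
  obtain g where g: "g \<in> \<Gamma>" using ne by blast
  \<comment> \<open>Every point of the ball is within \<open>r + dist c g\<close> of the point
    \<open>g\<close> of \<Gamma>.\<close>
  have "cball c r \<subseteq> N (r + dist c g)"
  proof
    fix y assume "y \<in> cball c r"
    then have "infdist y \<Gamma> \<le> r + dist c g"
      using g dist_triangle[of y g c] by (intro infdist_le2[OF g]) (auto simp: dist_commute)
    then show "y \<in> N (r + dist c g)" by (simp add: N_def)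
  qed
  then have "prob (cball c r) \<le> prob (N (r + dist c g))"
    by (intro finite_measure_mono) auto
  have one: "prob (N (\<rho> ^ k * (r + dist c g))) = 1" for k
  proof (induction k)
    case 0
    then show ?case using cr \<open>prob (cball c r) \<le> _\<close> prob_le_1 by (simp add: order_antisym)
  next
    case (Suc k)
    then show ?case
      using step[of "\<rho> ^ k * (r + dist c g)"] prob_le_1 by (simp add: order_antisym mult.assoc)
  qed
  have "AE y in \<mu>. \<forall>k. y \<in> N (\<rho> ^ k * (r + dist c g))"
    using one by (intro AE_all_countable[THEN iffD2] allI) (simp add: AE_in_set_eq_1)
  then show ?thesis
  proof (rule AE_mp, intro AE_I2 impI)
    fix y assume y: "\<forall>k. y \<in> N (\<rho> ^ k * (r + dist c g))"
    have "(\<lambda>k. \<rho> ^ k * (r + dist c g)) \<longlonglongrightarrow> 0"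
      using \<rho> by (intro tendsto_mult_left_zero LIMSEQ_power_zero) auto
    then have "infdist y \<Gamma> \<le> 0"
      using y by (intro LIMSEQ_le_const) (auto simp: N_def)
    then show "y \<in> \<Gamma>"
      using in_closed_iff_infdist_zero[OF compact_imp_closed[OF comp] ne, of y] infdist_nonneg[of y \<Gamma>]
      by simp
  qed
qed

text \<open>Invariance is given on sets only. It passes to integrals by writing \<mu> as the mixture
  of its images under the maps, a monadic bind over a random index.\<close>

lemma integral_invariant_measure:
  fixes S :: "'l::finite \<Rightarrow> real^'n \<Rightarrow> real^'n" and f :: "real^'n \<Rightarrow> real"
  assumes p: "probability_weights p" and mu: "is_invariant_measure S p \<mu>"
    and S: "\<And>l. S l \<in> borel_measurable borel"
    and f: "f \<in> borel_measurable borel" and bound: "\<And>y. \<bar>f y\<bar> \<le> B"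
  shows "(\<integral>y. f y \<partial>\<mu>) = (\<Sum>l\<in>UNIV. p l * (\<integral>y. f (S l y) \<partial>\<mu>))"
proof -
  interpret prob_space \<mu> using mu by (simp add: is_invariant_measure_def)
  have sets[measurable_cong, simp]: "sets \<mu> = sets borel"
    using mu by (simp add: is_invariant_measure_def)
  have space[simp]: "space \<mu> = UNIV"
    using sets_eq_imp_space_eq[OF sets] by simp
  note [measurable] = S f
  have p0: "\<And>l. 0 \<le> p l" and p1: "(\<Sum>l\<in>UNIV. p l) = 1"
    using p by (auto simp: probability_weights_def less_imp_le)
  \<comment> \<open>The law of the random index, with the weights as its probabilities.\<close>
  define \<pi> where "\<pi> = embed_pmf p"
  have pmf: "pmf \<pi> l = p l" for l
    unfolding \<pi>_def using p0 p1
    by (intro pmf_embed_pmf) (auto simp: nn_integral_count_space_finite sum_ennreal)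
  define N where "N l = distr \<mu> borel (S l)" for l
  have N: "N \<in> measurable (measure_pmf \<pi>) (subprob_algebra borel)"
    using prob_space_distr[of "S l" borel for l]
    by (auto simp: N_def space_subprob_algebra prob_space_imp_subprob_space)
  have "\<mu> = measure_pmf \<pi> \<bind> N"
  proof (rule measure_eqI)
    show "sets \<mu> = sets (measure_pmf \<pi> \<bind> N)"
      using sets_bind[of "measure_pmf \<pi>" N borel] by (simp add: N_def)
    fix X assume "X \<in> sets \<mu>"
    then have X: "X \<in> sets borel" by simp
    have "emeasure (measure_pmf \<pi> \<bind> N) X = (\<integral>\<^sup>+l. emeasure (N l) X \<partial>measure_pmf \<pi>)"
      using X N by (intro emeasure_bind) auto
    also have "\<dots> = (\<integral>\<^sup>+l. ennreal (prob (S l -` X)) \<partial>measure_pmf \<pi>)"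
      using X by (simp add: N_def emeasure_distr emeasure_eq_measure)
    also have "\<dots> = ennreal (\<integral>l. prob (S l -` X) \<partial>measure_pmf \<pi>)"
      by (intro nn_integral_eq_integral integrable_measure_pmf_finite) auto
    also have "(\<integral>l. prob (S l -` X) \<partial>measure_pmf \<pi>) = (\<Sum>l\<in>UNIV. p l * prob (S l -` X))"
      by (simp add: integral_measure_pmf[of UNIV] pmf)
    also have "\<dots> = prob X"
      using mu X by (simp add: is_invariant_measure_def)
    finally show "emeasure \<mu> X = emeasure (measure_pmf \<pi> \<bind> N) X"
      by (simp add: emeasure_eq_measure)
  qed
  then have "(\<integral>y. f y \<partial>\<mu>) = (\<integral>y. f y \<partial>(measure_pmf \<pi> \<bind> N))" by simp
  also have "\<dots> = (\<integral>l. \<integral>y. f y \<partial>N l \<partial>measure_pmf \<pi>)"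
  proof (rule integral_bind)
    show "N \<in> measurable (measure_pmf \<pi>) (subprob_algebra borel)" by (rule N)
    show "finite_measure (measure_pmf \<pi>)" by (rule measure_pmf.finite_measure_axioms)
    show "AE l in measure_pmf \<pi>. emeasure (N l) (space (N l)) \<le> ennreal 1"
      using emeasure_space_1 by (simp add: N_def emeasure_distr)
  qed (use f bound in auto)
  also have "\<dots> = (\<Sum>l\<in>UNIV. p l * (\<integral>y. f (S l y) \<partial>\<mu>))"
    by (simp add: integral_measure_pmf[of UNIV] pmf N_def integral_distr)
  finally show ?thesis .
qed

section \<open>Lagrange interpolation at unisolvent nodes\<close>

lemma sum_fun_apply: "(\<Sum>i\<in>I. f i) y = (\<Sum>i\<in>I. f i y)"
  for f :: "'i \<Rightarrow> 'a \<Rightarrow> real"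
  by (induction I rule: infinite_finite_induct) auto

lemma subspace_sum_smult:
  assumes "fun_vs.subspace P" "\<And>i. i \<in> I \<Longrightarrow> f i \<in> P"
  shows "(\<lambda>y. \<Sum>i\<in>I. c i * f i y) \<in> P"
proof -
  have "(\<Sum>i\<in>I. (\<lambda>y. c i * f i y)) \<in> P"
    using assms by (intro fun_vs.subspace_sum fun_vs.subspace_scale)
  moreover have "(\<Sum>i\<in>I. (\<lambda>y. c i * f i y)) = (\<lambda>y. \<Sum>i\<in>I. c i * f i y)"
    by (simp add: fun_eq_iff sum_fun_apply)
  ultimately show ?thesis by simp
qed

lemma unisolvent_eqI:
  assumes "unisolvent P x" "f \<in> P" "g \<in> P" "\<And>i. f (x i) = g (x i)"
  shows "f = g"
  using assms by (auto simp: unisolvent_def vec_eq_iff inj_on_def)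

text \<open>There are as many nodes as basis elements, so evaluating combinations of a basis at the
  nodes is a linear endomorphism. It is injective by unisolvence and independence, hence
  surjective.\<close>

lemma unisolvent_interpolation:
  fixes x :: "'m::finite \<Rightarrow> real^'n"
  assumes sub: "fun_vs.subspace P" and x: "unisolvent P x"
  shows "\<exists>q\<in>P. \<forall>i. q (x i) = v $ i"
proof -
  obtain B where B: "B \<subseteq> P" "fun_vs.independent B" "card B = fun_vs.dim P"
    using fun_vs.basis_exists by metis
  have card: "card B = CARD('m)" using B(3) x by (simp add: unisolvent_def)
  \<comment> \<open>An infinite set has \<open>card\<close> zero, so positive cardinality gives
    finiteness.\<close>
  then have fin: "finite B" by (intro card_ge_0_finite) simp
  obtain \<beta> :: "'m \<Rightarrow> real^'n \<Rightarrow> real" where \<beta>: "bij_betw \<beta> UNIV B"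
    using finite_same_card_bij[of "UNIV :: 'm set" B] fin card by auto
  have \<beta>P: "\<beta> k \<in> P" for k using \<beta> B(1) by (auto simp: bij_betw_def)
  define E :: "real^'m \<Rightarrow> real^'m" where "E c = (\<chi> i. \<Sum>k\<in>UNIV. c $ k * \<beta> k (x i))" for c
  have lin: "linear E"
    by (rule linearI) (auto simp: E_def vec_eq_iff sum.distrib algebra_simps sum_distrib_left)
  have "c = 0" if "E c = 0" for c
  proof -
    have "(\<lambda>y. \<Sum>k\<in>UNIV. c $ k * \<beta> k y) = (\<lambda>_. 0)"
    proof (rule unisolvent_eqI[OF x])
      show "(\<lambda>y. \<Sum>k\<in>UNIV. c $ k * \<beta> k y) \<in> P"
        using sub \<beta>P by (rule subspace_sum_smult)
      show "(\<lambda>_. 0) \<in> P"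
        using fun_vs.subspace_0[OF sub] by (simp add: zero_fun_def)
      show "(\<Sum>k\<in>UNIV. c $ k * \<beta> k (x i)) = 0" for i
        using that by (simp add: E_def vec_eq_iff)
    qed
    \<comment> \<open>The coefficients are re-indexed by the basis elements themselves, the form
      that \<open>fun_vs.independentD\<close> works with.\<close>
    define u where "u g = c $ (inv \<beta> g)" for g
    have inj: "inj \<beta>" using \<beta> by (simp add: bij_betw_def)
    have "(\<Sum>g\<in>B. (\<lambda>y. u g * g y)) = (\<Sum>k\<in>UNIV. (\<lambda>y. c $ k * \<beta> k y))"
      using \<beta> inj by (subst sum.reindex_bij_betw[OF \<beta>, symmetric]) (simp add: u_def)
    also have "\<dots> = 0"
      using \<open>_ = (\<lambda>_. 0)\<close> by (simp add: fun_eq_iff sum_fun_apply)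
    finally have "u (\<beta> k) = 0" for k
      using fun_vs.independentD[OF B(2) fin order_refl] \<beta> by (auto simp: bij_betw_def)
    then show "c = 0" using inj by (simp add: u_def vec_eq_iff)
  qed
  then have "inj E" using lin by (simp add: linear_injective_0)
  then have "surj E" using lin by (simp add: linear_injective_imp_surjective)
  then obtain c where "v = E c" by (metis surjD)
  then show ?thesis
    using subspace_sum_smult[where f = \<beta> and c = "\<lambda>k. c $ k", OF sub \<beta>P]
    by (intro bexI[of _ "\<lambda>y. \<Sum>k\<in>UNIV. c $ k * \<beta> k y"]) (auto simp: E_def)
qed

text \<open>Existence by interpolation and uniqueness by unisolvence justify the definite
  description.\<close>

lemma lagrange:
  assumes "fun_vs.subspace P" "unisolvent P x"
  shows "lagrange P x i \<in> P" "lagrange P x i (x j) = (if i = j then 1 else 0)"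
proof -
  obtain q where q: "q \<in> P" "\<And>j. q (x j) = (if i = j then 1 else 0)"
    using unisolvent_interpolation[OF assms, of "\<chi> j. if i = j then 1 else 0"] by auto
  have "\<exists>!q. q \<in> P \<and> (\<forall>j. q (x j) = (if i = j then 1 else 0))"
    using q by (auto intro!: ex1I[of _ q] unisolvent_eqI[OF assms(2)])
  from theI'[OF this, folded lagrange_def]
  show "lagrange P x i \<in> P" "lagrange P x i (x j) = (if i = j then 1 else 0)" by auto
qed

lemma lagrange_interpolation:
  assumes "fun_vs.subspace P" "unisolvent P x" "q \<in> P"
  shows "q = (\<lambda>y. \<Sum>i\<in>UNIV. q (x i) * lagrange P x i y)"
proof (rule unisolvent_eqI[OF assms(2,3)])
  show "(\<lambda>y. \<Sum>i\<in>UNIV. q (x i) * lagrange P x i y) \<in> P"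
    using assms lagrange by (intro subspace_sum_smult) auto
qed (simp add: lagrange(2)[OF assms(1,2)] mult_delta_right)

section \<open>The transfer matrix and the kernel of \<open>I - T\<close>\<close>

text \<open>In the Lagrange basis, the transfer matrix represents the Ruelle operator on \<open>P\<close>.\<close>

lemma transfer_matrix_mult:
  assumes "fun_vs.subspace P" "unisolvent P x" "q \<in> P"
  shows "transfer_matrix S p P x *v (\<chi> i. q (x i)) = (\<chi> i. ruelle S p q (x i))"
proof -
  have "(\<Sum>j\<in>UNIV. (\<Sum>l\<in>UNIV. p l * lagrange P x j (S l y)) * q (x j)) = ruelle S p q y" for y
  proof -
    have "(\<Sum>j\<in>UNIV. (\<Sum>l\<in>UNIV. p l * lagrange P x j (S l y)) * q (x j)) =
        (\<Sum>j\<in>UNIV. \<Sum>l\<in>UNIV. p l * (q (x j) * lagrange P x j (S l y)))"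
      unfolding sum_distrib_right by (simp only: mult.assoc mult.commute[of "q _"])
    also have "\<dots> = (\<Sum>l\<in>UNIV. p l * (\<Sum>j\<in>UNIV. q (x j) * lagrange P x j (S l y)))"
      by (subst sum.swap) (simp add: sum_distrib_left)
    also have "\<dots> = ruelle S p q y"
      \<comment> \<open>Only the occurrence of \<open>q\<close> on the right-hand side is expanded;
        the node values \<open>q (x j)\<close> must stay.\<close>
      unfolding ruelle_def by (subst (2) lagrange_interpolation[OF assms]) simp
    finally show ?thesis .
  qed
  then show ?thesis
    by (simp add: transfer_matrix_def matrix_vector_mult_def)
qed
text \<open>The sublevel sets of the distance to \<open>\<Gamma>\<close> are compact, invariant under every \<open>S l\<close>,
  and exhaust the space, so any two nodes lie in one of them.\<close>

lemma transfer_matrix_defect_constant: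
  fixes S :: "'l::finite \<Rightarrow> real^'n \<Rightarrow> real^'n" and x :: "'m::finite \<Rightarrow> real^'n"
  assumes p: "probability_weights p" and G: "is_attractor S \<Gamma>"
    and \<rho>: "0 \<le> \<rho>" "\<rho> < 1" "\<And>l y z. dist (S l y) (S l z) \<le> \<rho> * dist y z"
    and P: "finite_dim_poly_space P" and inv: "ifs_invariant_space S p P" and x: "unisolvent P x"
    and eq: "v - transfer_matrix S p P x *v v = c *\<^sub>R 1"
  shows "c = 0 \<and> v $ i = v $ j"
proof -
  have sub: "fun_vs.subspace P" using P by (simp add: finite_dim_poly_space_def)
  obtain q where q: "q \<in> P" "\<And>i. q (x i) = v $ i"
    using unisolvent_interpolation[OF sub x] by metis
  have v: "v = (\<chi> i. q (x i))" by (simp add: q(2) vec_eq_iff)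
  have P_const: "(\<lambda>_. c) \<in> P" and P_ruelle: "ruelle S p q \<in> P"
    using inv q(1) by (auto simp: ifs_invariant_space_def)
  \<comment> \<open>The vector equation gives this identity at the nodes only. Both sides lie in
    \<open>P\<close>, which contains the constants and is invariant, so it holds everywhere.\<close>
  have "q = ruelle S p q + (\<lambda>_. c)"
  proof (rule unisolvent_eqI[OF x q(1)])
    show "ruelle S p q + (\<lambda>_. c) \<in> P"
      using sub P_ruelle P_const by (rule fun_vs.subspace_add)
    show "q (x i) = (ruelle S p q + (\<lambda>_. c)) (x i)" for i
      using eq[unfolded v transfer_matrix_mult[OF sub x q(1)]]
      by (simp add: vec_eq_iff algebra_simps)
  qed
  then have *: "q z = ruelle S p q z + c" for z
    by (metis plus_fun_apply)
  have ne: "\<Gamma> \<noteq> {}" and comp: "compact \<Gamma>" and Ginv: "\<And>l. S l ` \<Gamma> \<subseteq> \<Gamma>"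
    using G unfolding is_attractor_def by blast+
  \<comment> \<open>The summand \<open>1\<close> keeps \<open>t\<close> positive for
    \<open>compact_infdist_le\<close>, even if both nodes lie in \<Gamma>; the other two put both
    nodes into the sublevel set.\<close>
  define t where "t = 1 + infdist (x i) \<Gamma> + infdist (x j) \<Gamma>"
  have t: "t > 0" "infdist (x i) \<Gamma> \<le> t" "infdist (x j) \<Gamma> \<le> t"
    using infdist_nonneg[of "x i" \<Gamma>] infdist_nonneg[of "x j" \<Gamma>] by (auto simp: t_def)
  have "S l ` {y. infdist y \<Gamma> \<le> t} \<subseteq> {y. infdist y \<Gamma> \<le> t}" for l
  proof clarify
    fix y assume y: "infdist y \<Gamma> \<le> t"
    have "infdist (S l y) \<Gamma> \<le> \<rho> * infdist y \<Gamma>"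
      using comp ne Ginv \<rho>(3)
      by (intro infdist_image_le_contraction) (auto simp: compact_imp_closed)
    also have "\<dots> \<le> infdist y \<Gamma>"
      using \<rho> infdist_nonneg by (intro mult_left_le_one_le) auto
    finally show "infdist (S l y) \<Gamma> \<le> t" using y by simp
  qed
  moreover have "continuous_on {y. infdist y \<Gamma> \<le> t} q"
    using P q(1) continuous_on_polymonial_function
    by (auto simp: finite_dim_poly_space_def real_polynomial_function_eq)
  ultimately have "c = 0 \<and> q (x i) = q (x j)"
    using t by (intro ruelle_defect_const[OF p compact_infdist_le[OF ne comp t(1)] _ \<rho> _ *]) auto
  then show ?thesis by (simp add: q(2))
qed

section \<open>Uniqueness of the weights by duality\<close>

text \<open>Adding to \<open>I - T\<close> the coordinate sum times the all-ones vector yields an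
  injective, hence surjective map. The difference of two solutions is fixed by
  \<open>transpose T\<close> and has coordinate sum zero, so it is orthogonal to the range of that
  map and vanishes.\<close>

lemma solves_weight_problem_unique:
  fixes T :: "real^'m^'m"
  assumes T: "\<And>v c i j. v - T *v v = c *\<^sub>R 1 \<Longrightarrow> c = 0 \<and> v $ i = v $ j"
    and u: "solves_weight_problem T u" and w: "solves_weight_problem T w"
  shows "u = w"
proof -
  define d where "d = u - w"
  have T_d: "transpose T *v d = d" and sum_d: "(\<Sum>i\<in>UNIV. d $ i) = 0"
    using u w by (simp_all add: d_def solves_weight_problem_def matrix_kernel_def
      matrix_vector_mult_diff_distrib matrix_vector_mult_diff_rdistrib sum_subtractf)
  text \<open>\<open>E\<close> is bijective, whereas \<open>d\<close> is orthogonal to its range.\<close>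
  define E where "E v = v - T *v v + (\<Sum>i\<in>UNIV. v $ i) *\<^sub>R 1" for v
  have lin: "linear E"
    by (rule linearI)
       (simp_all add: E_def matrix_vector_right_distrib matrix_vector_mult_scaleR sum.distrib
          scaleR_left_distrib scaleR_right_diff_distrib scaleR_right_distrib flip: sum_distrib_left)
  have "v = 0" if "E v = 0" for v
  proof -
    \<comment> \<open>A zero of \<open>E\<close> satisfies the assumption with \<open>c\<close>
      equal to minus its coordinate sum; hence that sum vanishes and all coordinates agree.\<close>
    have "v - T *v v = (- (\<Sum>i\<in>UNIV. v $ i)) *\<^sub>R 1"
      using that by (simp add: E_def add_eq_0_iff2)
    from T[OF this] have s: "(\<Sum>i\<in>UNIV. v $ i) = 0" and c: "\<And>i j. v $ i = v $ j" by auto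
    have "(\<Sum>i\<in>UNIV. v $ i) = CARD('m) * v $ j" for j
      by (subst c[of _ j]) simp
    with s show "v = 0" by (simp add: vec_eq_iff)
  qed
  then have "inj E" using lin by (simp add: linear_injective_0)
  then have "surj E" using lin by (simp add: linear_injective_imp_surjective)
  then obtain v where v: "d = E v" by (metis surjD)
  have "d \<bullet> E v = d \<bullet> v - (transpose T *v d) \<bullet> v + (\<Sum>i\<in>UNIV. v $ i) * (d \<bullet> 1)"
    by (simp add: E_def inner_add_right inner_diff_right dot_lmul_matrix[symmetric]
        transpose_matrix_vector)
  also have "d \<bullet> 1 = 0"
    using sum_d by (simp add: inner_vec_def)
  finally have "d \<bullet> d = 0" using T_d v by simp
  then show ?thesis by (simp add: d_def)
qed

section \<open>Existence of a solution and exactness of the cubature weights\<close>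

text \<open>The bound on \<open>q\<close> holds only on \<Gamma>, while invariance of integrals is
  available for globally bounded functions, so \<open>q\<close> is cut off outside \<Gamma>. The
  cut-off changes no integral, since \<Gamma> has full measure and is mapped into itself.\<close>

lemma integral_attractor_ruelle:
  fixes S :: "'l::finite \<Rightarrow> real^'n \<Rightarrow> real^'n"
  assumes p: "probability_weights p" and mu: "is_invariant_measure S p \<mu>"
    and G: "is_attractor S \<Gamma>"
    and S: "\<And>l. S l \<in> borel_measurable borel"
    and AE: "AE y in \<mu>. y \<in> \<Gamma>"
    and q: "q \<in> borel_measurable borel" "\<And>y. y \<in> \<Gamma> \<Longrightarrow> \<bar>q y\<bar> \<le> B"
  shows "(LINT y:\<Gamma>|\<mu>. ruelle S p q y) = (LINT y:\<Gamma>|\<mu>. q y)"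
proof -
  interpret prob_space \<mu> using mu by (simp add: is_invariant_measure_def)
  have sets[measurable_cong, simp]: "sets \<mu> = sets borel"
    using mu by (simp add: is_invariant_measure_def)
  note [measurable] = S q(1)
  have [measurable]: "\<Gamma> \<in> sets borel" and inv: "\<And>l y. y \<in> \<Gamma> \<Longrightarrow> S l y \<in> \<Gamma>" and ne: "\<Gamma> \<noteq> {}"
    using G by (auto simp: is_attractor_def borel_compact)
  define g where "g y = indicator \<Gamma> y * q y" for y
  have [measurable]: "g \<in> borel_measurable borel" unfolding g_def by measurable
  \<comment> \<open>The constant \<open>B\<close> must also bound the value zero that
    \<open>g\<close> takes outside \<Gamma>.\<close>
  have "0 \<le> B" using ne q(2) abs_ge_zero order_trans by blast
  then have g: "\<bar>g y\<bar> \<le> B" for y using q(2) by (simp add: g_def indicator_def)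
  have "(LINT y:\<Gamma>|\<mu>. ruelle S p q y) = (\<integral>y. (\<Sum>l\<in>UNIV. p l * g (S l y)) \<partial>\<mu>)"
    unfolding set_lebesgue_integral_def ruelle_def
    by (rule integral_cong_AE) (measurable, use AE in eventually_elim, simp add: g_def inv)
  also have "\<dots> = (\<Sum>l\<in>UNIV. p l * (\<integral>y. g (S l y) \<partial>\<mu>))"
    using g by (subst Bochner_Integration.integral_sum)
      (auto intro!: integrable_mult_right integrable_const_bound[where B = B])
  also have "\<dots> = (\<integral>y. g y \<partial>\<mu>)"
    using integral_invariant_measure[OF p mu S _ g] by simp
  also have "\<dots> = (LINT y:\<Gamma>|\<mu>. q y)"
    by (simp add: g_def set_lebesgue_integral_def)
  finally show ?thesis .
qed

theorem theorem3p5: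
  fixes A :: "'l::finite \<Rightarrow> real^'n^'n" and b :: "'l \<Rightarrow> real^'n"
    and S :: "'l \<Rightarrow> real^'n \<Rightarrow> real^'n"
    and p :: "'l \<Rightarrow> real" and \<mu> :: "(real^'n) measure" and \<Gamma> :: "(real^'n) set"
    and P :: "(real^'n \<Rightarrow> real) set" and x :: "'m::finite \<Rightarrow> real^'n"
  defines "S \<equiv> (\<lambda>l. affine_map (A l) (b l))"
  assumes "contractive_affine_ifs A"
    and "is_attractor S \<Gamma>"
    and "probability_weights p"
    and "is_invariant_measure S p \<mu>"
    and "finite_dim_poly_space P"
    and "ifs_invariant_space S p P"
    and "unisolvent P x"
  shows "(\<exists>!w. solves_weight_problem (transfer_matrix S p P x) w) \<and>
         (\<forall>w. solves_weight_problem (transfer_matrix S p P x) w \<longrightarrow>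
              (\<forall>i. w $ i = (LINT y:\<Gamma>|\<mu>. lagrange P x i y)))"
proof -
  note G = assms(3) and p = assms(4) and mu = assms(5) and P = assms(6) and inv = assms(7)
    and x = assms(8)
  interpret prob_space \<mu> using mu by (simp add: is_invariant_measure_def)
  have sets[measurable_cong, simp]: "sets \<mu> = sets borel"
    using mu by (simp add: is_invariant_measure_def)
  have sub: "fun_vs.subspace P" using P by (simp add: finite_dim_poly_space_def)
  \<comment> \<open>A common contraction factor for the finitely many maps.\<close>
  define \<rho> where "\<rho> = Max (range (\<lambda>l. onorm ((*v) (A l))))"
  have onorm_le: "onorm ((*v) (A l)) \<le> \<rho>" for l
    by (simp add: \<rho>_def)
  have "0 \<le> \<rho>"
    using onorm_le onorm_pos_le[OF matrix_vector_mul_bounded_linear] order_trans by blast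
  moreover have "\<rho> < 1"
    using assms(2) by (simp add: \<rho>_def contractive_affine_ifs_def)
  moreover have "dist (S l y) (S l z) \<le> \<rho> * dist y z" for l y z
  proof -
    have "dist (S l y) (S l z) = norm (A l *v (y - z))"
      by (simp add: S_def affine_map_def dist_norm matrix_vector_mult_diff_distrib)
    also have "\<dots> \<le> onorm ((*v) (A l)) * norm (y - z)"
      by (rule onorm) (rule matrix_vector_mul_bounded_linear)
    also have "\<dots> \<le> \<rho> * norm (y - z)"
      by (intro mult_right_mono onorm_le) simp
    finally show ?thesis by (simp add: dist_norm)
  qed
  ultimately have \<rho>: "0 \<le> \<rho>" "\<rho> < 1" "\<And>l y z. dist (S l y) (S l z) \<le> \<rho> * dist y z"
    by blast+
  have S: "S l \<in> borel_measurable borel" for l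
    unfolding S_def affine_map_def
    by (intro borel_measurable_continuous_onI continuous_intros matrix_vector_mult_linear_continuous_on)
  have AE: "AE y in \<mu>. y \<in> \<Gamma>"
    using p mu G S \<rho> by (rule AE_in_attractor)
  have comp: "compact \<Gamma>" using G by (simp add: is_attractor_def)
  then have [measurable]: "\<Gamma> \<in> sets borel" by (rule borel_compact)
  have cont: "continuous_on K q" if "q \<in> P" for q K
    using P that continuous_on_polymonial_function
    by (auto simp: finite_dim_poly_space_def real_polynomial_function_eq)
  define I where "I q = (LINT y:\<Gamma>|\<mu>. q y)" for q :: "real^'n \<Rightarrow> real"
  define w where "w = (\<chi> i. I (lagrange P x i))"
  have bounded: "\<exists>B. \<forall>y\<in>\<Gamma>. \<bar>q y\<bar> \<le> B" if q: "q \<in> P" for q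
    using compact_imp_bounded[OF compact_continuous_image[OF cont[OF q] comp]]
    by (auto simp: bounded_iff)
  have integrable: "set_integrable \<mu> \<Gamma> q" if q: "q \<in> P" for q
  proof -
    have [measurable]: "q \<in> borel_measurable borel"
      using cont[OF q] by (rule borel_measurable_continuous_onI)
    obtain B where B: "\<And>y. y \<in> \<Gamma> \<Longrightarrow> \<bar>q y\<bar> \<le> B" using bounded[OF q] by blast
    show ?thesis
      unfolding set_integrable_def using AE
      by (intro integrable_const_bound[where B = B]) (auto simp: B elim!: eventually_mono)
  qed
  \<comment> \<open>Integrating the Lagrange expansion of \<open>q\<close> shows that the weights
    \<open>w\<close> are exact on all of \<open>P\<close>.\<close>
  have cubature: "I q = (\<Sum>i\<in>UNIV. q (x i) * w $ i)" if q: "q \<in> P" for q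
  proof -
    have "I q = I (\<lambda>y. \<Sum>i\<in>UNIV. q (x i) * lagrange P x i y)"
      using lagrange_interpolation[OF sub x q] by simp
    also have "\<dots> = (\<integral>y. (\<Sum>i\<in>UNIV. q (x i) * (indicator \<Gamma> y * lagrange P x i y)) \<partial>\<mu>)"
      by (simp only: I_def set_lebesgue_integral_def real_scaleR_def sum_distrib_left mult.left_commute)
    also have "\<dots> = (\<Sum>i\<in>UNIV. q (x i) * w $ i)"
      using integrable[OF lagrange(1)[OF sub x]]
      by (simp add: I_def w_def set_lebesgue_integral_def set_integrable_def)
    finally show ?thesis .
  qed
  have invariance: "I (ruelle S p q) = I q" if q: "q \<in> P" for q
  proof -
    obtain B where "\<And>y. y \<in> \<Gamma> \<Longrightarrow> \<bar>q y\<bar> \<le> B" using bounded[OF q] by blast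
    then show ?thesis
      unfolding I_def using cont[OF q]
      by (intro integral_attractor_ruelle[OF p mu G S AE] borel_measurable_continuous_onI)
  qed
  have w: "solves_weight_problem (transfer_matrix S p P x) w"
    unfolding solves_weight_problem_def matrix_kernel_def mem_Collect_eq
  proof
    \<comment> \<open>Coordinate \<open>j\<close> is exactness of the weights for
      \<open>ruelle S p (lagrange P x j)\<close>: its integral is \<open>w $ j\<close> by
      invariance, and its node values form column \<open>j\<close> of the transfer matrix.\<close>
    have "(transpose (transfer_matrix S p P x) *v w) $ j = w $ j" for j
    proof -
      have "lagrange P x j \<in> P" "ruelle S p (lagrange P x j) \<in> P"
        using lagrange(1)[OF sub x] inv by (auto simp: ifs_invariant_space_def)
      then have "w $ j = (\<Sum>i\<in>UNIV. ruelle S p (lagrange P x j) (x i) * w $ i)"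
        by (metis (no_types) w_def vec_lambda_beta invariance cubature)
      then show ?thesis
        by (simp add: matrix_vector_mult_def transpose_def transfer_matrix_def ruelle_def)
    qed
    then show "(mat 1 - transpose (transfer_matrix S p P x)) *v w = 0"
      by (simp add: vec_eq_iff matrix_vector_mult_diff_rdistrib)
    \<comment> \<open>The normalization is exactness for the constant one, combined with the full
      mass of \<Gamma>.\<close>
    have "(\<lambda>_. 1) \<in> P" using inv by (simp add: ifs_invariant_space_def)
    then have "(\<Sum>i\<in>UNIV. w $ i) = I (\<lambda>_. 1)" by (simp add: cubature)
    also have "\<dots> = 1"
      using AE by (simp add: I_def set_lebesgue_integral_def AE_in_set_eq_1)
    finally show "(\<Sum>i\<in>UNIV. w $ i) = 1" .
  qed
  have "u = w" if "solves_weight_problem (transfer_matrix S p P x) u" for u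
    using transfer_matrix_defect_constant[OF p G \<rho> P inv x] that w
    by (rule solves_weight_problem_unique)
  moreover have "w $ i = (LINT y:\<Gamma>|\<mu>. lagrange P x i y)" for i
    by (simp add: w_def I_def)
  ultimately show ?thesis using w by blast
qed

end
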